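(* Let $a, c$ be real numbers with $ac > 0$, and let $S_{a,c} : \mathbb{R} \to \mathbb{R}$ be the map $S_{a,c}(x) = a - c x^2$. Then: (a) when $ac < 7/4$, $S_{a,c}$ has no period-3 orbits; (b) when $ac = 7/4$, $S_{a,c}$ has exactly one period-3 orbit; (c) when $ac > 7/4$, $S_{a,c}$ has exactly two period-3 orbits.
   Context: All maps are maps of the real line to itself and all periodic points are real. A period-3 point of a map $g : \mathbb{R} \to \mathbb{R}$ is a point $x \in \mathbb{R}$ of least period 3, i.e. $g(g(g(x))) = x$ and $x$, $g(x)$, $g(g(x))$ are pairwise distinct. A period-3 orbit of $g$ is a set $\{x, g(x), g(g(x))\}$ where $x$ is a period-3 point of $g$; orbits are counted as sets. *)

theory Defs
  imports Complex_Main
begin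

definition period3_point :: "(real \<Rightarrow> real) \<Rightarrow> real \<Rightarrow> bool" where
  "period3_point g x \<longleftrightarrow>
     g (g (g x)) = x \<and> x \<noteq> g x \<and> g x \<noteq> g (g x) \<and> x \<noteq> g (g x)"

definition period3_orbits :: "(real \<Rightarrow> real) \<Rightarrow> real set set" where
  "period3_orbits g = {{x, g x, g (g x)} | x. period3_point g x}"

definition S :: "real \<Rightarrow> real \<Rightarrow> real \<Rightarrow> real" where
  "S a c x = a - c * x\<^sup>2"

end

theory Submission
  imports Defs "HOL-Computational_Algebra.Polynomial"
begin

text \<open>
  Scaling by \<open>c\<close> conjugates \<open>S a c\<close> to \<open>x \<mapsto> m - x\<^sup>2\<close> with \<open>m = a c\<close>. If \<open>s\<close> is the sum
  of the points of a period-3 orbit of the latter, then \<open>m = s\<^sup>2 - s + 2\<close> and the orbit is the root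
  set of a monic cubic whose coefficients depend on \<open>s\<close> only. Conversely, a real root of this cubic
  always has least period 3, so that the period-3 orbits correspond to the real solutions
  \<open>s = 1/2 \<plusminus> sqrt (m - 7/4)\<close> of \<open>m = s\<^sup>2 - s + 2\<close>.
\<close>

text \<open>As 3 is prime, the least period of a point fixed by the third iterate is 1 or 3.\<close>

lemma period3_point_iff:
  "period3_point g x \<longleftrightarrow> g (g (g x)) = x \<and> g x \<noteq> x"
  unfolding period3_point_def by metis

text \<open>Injectivity of \<open>h\<close> transports (in)equalities along the orbit; surjectivity
  makes every point of \<open>k\<close> an image \<open>h x\<close>.\<close>

lemma period3_orbits_conjugate:
  assumes "bij h" and conj: "\<And>x. h (g x) = k (h x)"
  shows "period3_orbits k = (`) h ` period3_orbits g"
proof -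
  have iff: "period3_point k (h x) \<longleftrightarrow> period3_point g x" for x
    using bij_is_inj[OF \<open>bij h\<close>] unfolding period3_point_iff conj[symmetric]
    by (simp add: inj_eq)
  have "period3_orbits k = {{h x, k (h x), k (k (h x))} | x. period3_point k (h x)}"
    unfolding period3_orbits_def using bij_is_surj[OF \<open>bij h\<close>] by (metis surjD)
  also have "\<dots> = (`) h ` period3_orbits g"
    unfolding period3_orbits_def iff conj[symmetric] setcompr_eq_image image_image by simp
  finally show ?thesis .
qed

text \<open>The linear coefficient comes from the sum of squares: orbit points with sum s have
  squares summing to 3m - s, so their second symmetric function is (s^2 + s - 3m)/2, where m = s^2 -
  s + 2.\<close>

definition orbit_poly :: "real \<Rightarrow> real poly" where
  "orbit_poly s = [:s^3 - 2 * s\<^sup>2 + 3 * s - 1, - (s\<^sup>2 - 2 * s + 3), - s, 1:]"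

lemma poly_orbit_poly:
  "poly (orbit_poly s) x = x^3 - s * x\<^sup>2 - (s\<^sup>2 - 2 * s + 3) * x + (s^3 - 2 * s\<^sup>2 + 3 * s - 1)"
  unfolding orbit_poly_def by (simp add: algebra_simps power2_eq_square power3_eq_cube)

lemma orbit_poly_has_root: "\<exists>x. poly (orbit_poly s) x = 0"
proof -
  define q r where "q = s\<^sup>2 - 2 * s + 3" and "r = s^3 - 2 * s\<^sup>2 + 3 * s - 1"
  \<comment> \<open>A Cauchy-type bound: at \<open>N\<close> and \<open>- N\<close> the leading term
    outweighs all the others together.\<close>
  define N where "N = 1 + \<bar>s\<bar> + \<bar>q\<bar> + \<bar>r\<bar>"
  have "N \<ge> 1" by (simp add: N_def)
  then have N: "N \<le> N\<^sup>2" "1 \<le> N\<^sup>2" "0 < N\<^sup>2"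
    by (auto simp: power2_eq_square mult_le_cancel_left1 intro: order_trans)
  have s: "\<bar>s * N\<^sup>2\<bar> = \<bar>s\<bar> * N\<^sup>2" by (simp add: abs_mult)
  have q: "\<bar>q * N\<bar> \<le> \<bar>q\<bar> * N\<^sup>2"
    using N \<open>N \<ge> 1\<close> by (simp add: abs_mult mult_left_mono)
  have r: "\<bar>r\<bar> \<le> \<bar>r\<bar> * N\<^sup>2" using N mult_left_mono[of 1 "N\<^sup>2" "\<bar>r\<bar>"] by simp
  have cube: "N^3 = N\<^sup>2 + \<bar>s\<bar> * N\<^sup>2 + \<bar>q\<bar> * N\<^sup>2 + \<bar>r\<bar> * N\<^sup>2"
    by (simp add: N_def power3_eq_cube power2_eq_square algebra_simps)
  have "poly (orbit_poly s) N > 0"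
    unfolding poly_orbit_poly q_def[symmetric] r_def[symmetric]
    using s q r cube N by linarith
  moreover have "poly (orbit_poly s) (- N) < 0"
    unfolding poly_orbit_poly q_def[symmetric] r_def[symmetric]
    using s q r cube N by (simp add: power3_eq_cube) linarith
  ultimately show ?thesis
    using poly_IVT_pos[of "- N" N "orbit_poly s"] \<open>N \<ge> 1\<close> by auto
qed

text \<open>If the map permutes the roots r, both sides are the product of all r^2 - x^2. The
  identity shows that the map sends roots to roots.\<close>

lemma poly_orbit_poly_step:
  "poly (orbit_poly s) (S (s\<^sup>2 - s + 2) 1 x) = poly (orbit_poly s) x * poly (orbit_poly s) (- x)"
  unfolding poly_orbit_poly S_def by (simp add: algebra_simps power2_eq_square power3_eq_cube)

text \<open>Written in \<open>A\<close> and \<open>B\<close>, the cofactor is a quadratic form whose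
  coefficients 1 and \<open>2 - m\<close> are the sum and the product of the two solutions s of m =
  s^2 - s + 2.\<close>

lemma third_iterate_factorization:
  fixes m x :: real
  defines "A \<equiv> x^3 - (m + 1) * x + 1 - m" and "B \<equiv> m + x - x\<^sup>2"
  shows "S m 1 (S m 1 (S m 1 x)) - x = (S m 1 x - x) * (A\<^sup>2 + A * B + (2 - m) * B\<^sup>2)"
  unfolding S_def A_def B_def by (simp add: algebra_simps power2_eq_square power3_eq_cube)

text \<open>The quadratic cofactor above is the product of the cubics for \<open>s\<close> and \<open>1 - s\<close>, the
  two solutions of \<open>m = s\<^sup>2 - s + 2\<close>.\<close>

lemma poly_orbit_poly_linear:
  assumes "m = s\<^sup>2 - s + 2"
  shows "poly (orbit_poly s) x = x^3 - (m + 1) * x + 1 - m + s * (m + x - x\<^sup>2)"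
  unfolding poly_orbit_poly assms by (simp add: algebra_simps power2_eq_square power3_eq_cube)

lemma orbit_poly_root_unique:
  assumes "s\<^sup>2 - s = t\<^sup>2 - t" "poly (orbit_poly s) x = 0" "poly (orbit_poly t) x = 0"
  shows "s = t"
proof (rule ccontr)
  assume "s \<noteq> t"
  define m where "m = s\<^sup>2 - s + 2"
  have "m = t\<^sup>2 - t + 2" using assms(1) m_def by simp
  note lin = poly_orbit_poly_linear[OF m_def, of x] poly_orbit_poly_linear[OF this, of x]
  have "(s - t) * (m + x - x\<^sup>2) = 0" using assms(2,3) lin by (simp add: algebra_simps)
  with \<open>s \<noteq> t\<close> have B: "m + x - x\<^sup>2 = 0" by simp
  moreover from this have "x^3 - (m + 1) * x + 1 - m = 0" using lin(1) assms(2) by simp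
  \<comment> \<open>The second vanishing expression plus \<open>x + 1\<close> times the first is
    identically 1, so they have no common zero.\<close>
  ultimately have "(1::real) = 0" by algebra
  then show False by simp
qed

lemma period3_point_iff_root:
  "period3_point (S m 1) x \<longleftrightarrow> (\<exists>s. m = s\<^sup>2 - s + 2 \<and> poly (orbit_poly s) x = 0)"
proof
  define A B where "A = x^3 - (m + 1) * x + 1 - m" and "B = m + x - x\<^sup>2"
  note fact = third_iterate_factorization[of m x, folded A_def B_def]
  {
    assume "period3_point (S m 1) x"
    then have zero: "A\<^sup>2 + A * B + (2 - m) * B\<^sup>2 = 0"
      using fact by (auto simp: period3_point_iff)
    have "m \<ge> 7/4"
    proof (rule ccontr)
      assume m: "\<not> m \<ge> 7/4"
      \<comment> \<open>Completing the square reveals the threshold: below 7/4 the form is positive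
        definite, so \<open>A\<close> and \<open>B\<close> would both vanish.\<close>
      have "(A + B / 2)\<^sup>2 + (7/4 - m) * B\<^sup>2 = A\<^sup>2 + A * B + (2 - m) * B\<^sup>2"
        by (simp add: field_simps power2_eq_square)
      then have sq: "(A + B / 2)\<^sup>2 + (7/4 - m) * B\<^sup>2 = 0" using zero by simp
      moreover have "(7/4 - m) * B\<^sup>2 \<ge> 0" using m by simp
      ultimately have "(7/4 - m) * B\<^sup>2 = 0" by (smt (verit) zero_le_power2)
      then have "B = 0" using m by simp
      moreover have "A = 0" using sq \<open>B = 0\<close> by simp
      moreover have "A + x * B + B = 1"
        unfolding A_def B_def by (simp add: algebra_simps power2_eq_square power3_eq_cube)
      ultimately show False by simp
    qed
    define s where "s = 1/2 + sqrt (m - 7/4)"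
    have "(s - 1/2)\<^sup>2 = m - 7/4" using \<open>m \<ge> 7/4\<close> by (simp add: s_def)
    then have s: "m = s\<^sup>2 - s + 2" by (simp add: power2_eq_square algebra_simps)
    then have t: "m = (1 - s)\<^sup>2 - (1 - s) + 2" by (simp add: power2_eq_square algebra_simps)
    have "(A + s * B) * (A + (1 - s) * B) = A\<^sup>2 + A * B + (2 - m) * B\<^sup>2"
      unfolding s by (simp add: power2_eq_square algebra_simps)
    then have "poly (orbit_poly s) x * poly (orbit_poly (1 - s)) x = 0"
      using zero unfolding poly_orbit_poly_linear[OF s] poly_orbit_poly_linear[OF t]
        A_def[symmetric] B_def[symmetric] by simp
    then show "\<exists>s. m = s\<^sup>2 - s + 2 \<and> poly (orbit_poly s) x = 0"
      using s t by (metis mult_eq_0_iff)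
  }
  {
    assume "\<exists>s. m = s\<^sup>2 - s + 2 \<and> poly (orbit_poly s) x = 0"
    then obtain s where s: "m = s\<^sup>2 - s + 2" and root: "poly (orbit_poly s) x = 0" by blast
    have "A + s * B = 0"
      using root unfolding poly_orbit_poly_linear[OF s] A_def B_def .
    moreover have "A\<^sup>2 + A * B + (2 - m) * B\<^sup>2 = (A + s * B) * (A + (1 - s) * B)"
      unfolding s by (simp add: power2_eq_square algebra_simps)
    ultimately have "A\<^sup>2 + A * B + (2 - m) * B\<^sup>2 = 0" by simp
    then have "S m 1 (S m 1 (S m 1 x)) = x" using fact by simp
    moreover have "S m 1 x \<noteq> x"
    proof
      assume "S m 1 x = x"
      then have x: "x\<^sup>2 = m - x" by (simp add: S_def)
      have "x^3 = x * (m - x)"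
        unfolding x[symmetric] by (simp add: power2_eq_square power3_eq_cube)
      then have "A = 1 - 2 * m" "B = 2 * x"
        using x unfolding A_def B_def by (simp_all add: algebra_simps power2_eq_square)
      then have w: "2 * s * x = 2 * s\<^sup>2 - 2 * s + 3"
        using \<open>A + s * B = 0\<close> s by simp
      \<comment> \<open>To eliminate \<open>x\<close> without dividing by \<open>s\<close>, the
        fixed point equation \<open>x\<^sup>2 + x = m\<close> is multiplied by
        \<open>4 * s\<^sup>2\<close>, and \<open>2 * s * x\<close> is replaced by means of
        \<open>w\<close>.\<close>
      have "(2 * s * x)\<^sup>2 + 2 * s * (2 * s * x) = 4 * s\<^sup>2 * (x\<^sup>2 + x)"
        by (simp add: power2_eq_square algebra_simps)
      also have "\<dots> = 4 * s\<^sup>2 * (s\<^sup>2 - s + 2)" using x s by simp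
      finally have "(2 * s - 3/2)\<^sup>2 + 27/4 = 0"
        unfolding w by (simp add: power2_eq_square algebra_simps)
      then show False using zero_le_power2[of "2 * s - 3/2"] by linarith
    qed
    ultimately show "period3_point (S m 1) x" by (simp add: period3_point_iff)
  }
qed

text \<open>The orbit consists of three distinct roots, and a cubic has no more.\<close>

lemma period3_orbit_eq_roots:
  assumes m: "m = s\<^sup>2 - s + 2" and root: "poly (orbit_poly s) x = 0"
  shows "{x, S m 1 x, S m 1 (S m 1 x)} = {y. poly (orbit_poly s) y = 0}" (is "?O = ?R")
proof (rule card_subset_eq)
  have nz: "orbit_poly s \<noteq> 0" by (simp add: orbit_poly_def)
  show "finite ?R" using poly_roots_finite[OF nz] .
  have step: "poly (orbit_poly s) (S m 1 y) = 0" if "poly (orbit_poly s) y = 0" for y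
    using that poly_orbit_poly_step[of s y] m by simp
  show sub: "?O \<subseteq> ?R" using root step by simp
  have "period3_point (S m 1) x" using assms period3_point_iff_root by blast
  then have "card ?O = 3" by (simp add: period3_point_def)
  moreover have "card ?R \<le> 3"
    using card_poly_roots_bound[OF nz] by (simp add: orbit_poly_def)
  ultimately show "card ?O = card ?R"
    using card_mono[OF \<open>finite ?R\<close> sub] by linarith
qed

lemma period3_orbits_eq_image:
  "period3_orbits (S m 1) = (\<lambda>s. {y. poly (orbit_poly s) y = 0}) ` {s. m = s\<^sup>2 - s + 2}"
  (is "_ = ?R ` ?Q")
proof (intro equalityI subsetI)
  fix X assume "X \<in> period3_orbits (S m 1)"
  then obtain x where X: "X = {x, S m 1 x, S m 1 (S m 1 x)}" and "period3_point (S m 1) x"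
    unfolding period3_orbits_def by blast
  then obtain s where s: "m = s\<^sup>2 - s + 2" "poly (orbit_poly s) x = 0"
    using period3_point_iff_root by blast
  have "X = ?R s" unfolding X by (rule period3_orbit_eq_roots[OF s])
  with s(1) show "X \<in> ?R ` ?Q" by blast
next
  fix X assume "X \<in> ?R ` ?Q"
  then obtain s where s: "m = s\<^sup>2 - s + 2" "X = ?R s" by blast
  obtain x where x: "poly (orbit_poly s) x = 0" using orbit_poly_has_root by blast
  then have "X = {x, S m 1 x, S m 1 (S m 1 x)}" "period3_point (S m 1) x"
    using s(2) period3_orbit_eq_roots[OF s(1) x] period3_point_iff_root[of m x] s(1) x
    by (simp, blast)
  then show "X \<in> period3_orbits (S m 1)" unfolding period3_orbits_def by blast
qed

text \<open>Root sets are nonempty, so equal ones share a root, which for fixed \<open>m\<close>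
  determines \<open>s\<close>.\<close>

lemma inj_on_orbit_poly_roots:
  "inj_on (\<lambda>s. {y. poly (orbit_poly s) y = 0}) {s. m = s\<^sup>2 - s + 2}"
proof (rule inj_onI)
  fix s t
  assume "s \<in> {s. m = s\<^sup>2 - s + 2}" "t \<in> {s. m = s\<^sup>2 - s + 2}"
    and eq: "{y. poly (orbit_poly s) y = 0} = {y. poly (orbit_poly t) y = 0}"
  then have "s\<^sup>2 - s = t\<^sup>2 - t" by simp
  moreover obtain x where "poly (orbit_poly s) x = 0" using orbit_poly_has_root by blast
  ultimately show "s = t" using eq orbit_poly_root_unique by blast
qed

lemma card_period3_orbits_normalized:
  "card (period3_orbits (S m 1)) = card {s. m = s\<^sup>2 - s + 2}"
  unfolding period3_orbits_eq_image by (rule card_image[OF inj_on_orbit_poly_roots])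

lemma orbit_sums:
  fixes m :: real
  shows "{s. m = s\<^sup>2 - s + 2} =
    (if m < 7/4 then {} else {1/2 - sqrt (m - 7/4), 1/2 + sqrt (m - 7/4)})"
proof -
  have "m = s\<^sup>2 - s + 2 \<longleftrightarrow> (s - 1/2)\<^sup>2 = m - 7/4" for s
  proof -
    have "(s - 1/2)\<^sup>2 = s\<^sup>2 - s + 1/4"
      by (simp add: power2_eq_square algebra_simps)
    then show ?thesis by linarith
  qed
  moreover have "(s - 1/2)\<^sup>2 = m - 7/4 \<longleftrightarrow> s = 1/2 - sqrt (m - 7/4) \<or> s = 1/2 + sqrt (m - 7/4)"
    if "m \<ge> 7/4" for s
  proof -
    have "(s - 1/2)\<^sup>2 = (sqrt (m - 7/4))\<^sup>2 \<longleftrightarrow>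
        s - 1/2 = sqrt (m - 7/4) \<or> s - 1/2 = - sqrt (m - 7/4)"
      by (rule power2_eq_iff)
    then show ?thesis using that by auto
  qed
  moreover have "(s - 1/2)\<^sup>2 \<noteq> m - 7/4" if "m < 7/4" for s
    using that zero_le_power2[of "s - 1/2"] by linarith
  ultimately show ?thesis by auto
qed

theorem theorem1:
  fixes a c :: real
  assumes "a * c > 0"
  shows "(a * c < 7 / 4 \<longrightarrow> period3_orbits (S a c) = {}) \<and>
         (a * c = 7 / 4 \<longrightarrow> card (period3_orbits (S a c)) = 1) \<and>
         (a * c > 7 / 4 \<longrightarrow> card (period3_orbits (S a c)) = 2)"
proof -
  let ?h = "\<lambda>x. c * x"
  have "c \<noteq> 0" using assms by auto
  then have "bij ?h" by (intro bij_betw_byWitness[where f' = "\<lambda>x. x / c"]) auto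
  moreover have "c * S a c x = S (a * c) 1 (c * x)" for x
    by (simp add: S_def algebra_simps power2_eq_square)
  ultimately have conj: "period3_orbits (S (a * c) 1) = (`) ?h ` period3_orbits (S a c)"
    by (rule period3_orbits_conjugate)
  have "inj ((`) ?h)" using bij_is_inj[OF \<open>bij ?h\<close>] by (rule inj_on_image[OF inj_on_subset]) auto
  then have "card (period3_orbits (S a c)) = card (period3_orbits (S (a * c) 1))"
    unfolding conj by (metis card_image inj_on_subset subset_UNIV)
  \<comment> \<open>Cardinality 0 would also allow an infinite set, so emptiness is read off the
    sets themselves.\<close>
  moreover have "period3_orbits (S a c) = {}" if "a * c < 7/4"
    using conj that period3_orbits_eq_image[of "a * c"] by (simp add: orbit_sums)
  \<comment> \<open>With \<open>d = a * c - 7/4\<close>, the two orbit sums merge exactly at the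
    threshold.\<close>
  moreover have "card {1/2 - sqrt d, 1/2 + sqrt d} = (if d = 0 then 1 else 2)" for d
    by auto
  ultimately show ?thesis
    unfolding card_period3_orbits_normalized orbit_sums by simp
qed

end
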